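(* There is a set $X \subseteq \omega^{\uparrow\omega}$ with $X \in v^0$ and $X \notin r^0$, i.e. $v^0 \setminus r^0 \neq \emptyset$.
   Context: $\omega^{\uparrow<\omega}$ denotes the set of strictly increasing finite sequences of natural numbers and $\omega^{\uparrow\omega}$ the set of strictly increasing infinite sequences (identified with infinite subsets of $\omega$ via increasing enumeration). A tree is a nonempty subset $T\subseteq\omega^{\uparrow<\omega}$ closed under initial segments; $[T]$ is its set of infinite branches in $\omega^{\uparrow\omega}$. For a family $\mathbb P$ of trees, the associated ideal consists of all $X\subseteq\omega^{\uparrow\omega}$ such that for every $T\in\mathbb P$ there is $T'\in\mathbb P$ with $T'\subseteq T$ and $[T']\cap X=\emptyset$. A Silver tree is determined by a partial function $f$ from $\omega$ to $2$ with coinfinite domain; it is the tree of all finite initial segments of increasing enumerations of infinite sets $x\subseteq\omega$ with $x\cap\operatorname{dom}(f)=f^{-1}(\{1\})$; $v^0$ is the ideal associated with Silver trees. A Mathias tree is determined by a finite set $s\subseteq\omega$ and an infinite set $A\subseteq\omega$ with $\max s<\min A$; it is the tree of all finite initial segments of increasing enumerations of sets $s\cup y$ with $y\subseteq A$ infinite; $r^0$ is the ideal associated with Mathias trees. *)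

theory Defs
  imports "HOL-Library.Infinite_Set" "HOL-Library.Sublist"
begin

definition incr_fin :: "nat list set" where
  "incr_fin = {t. sorted_wrt (<) t}"

definition incr_inf :: "(nat \<Rightarrow> nat) set" where
  "incr_inf = {x. strict_mono x}"

definition init_seg :: "(nat \<Rightarrow> nat) \<Rightarrow> nat \<Rightarrow> nat list" where
  "init_seg x n = map x [0..<n]"

definition is_tree :: "nat list set \<Rightarrow> bool" where
  "is_tree T \<longleftrightarrow> T \<noteq> {} \<and> T \<subseteq> incr_fin \<and> (\<forall>t\<in>T. \<forall>u. prefix u t \<longrightarrow> u \<in> T)"

definition branches :: "nat list set \<Rightarrow> (nat \<Rightarrow> nat) set" where
  "branches T = {x \<in> incr_inf. \<forall>n. init_seg x n \<in> T}"

definition tree_ideal :: "nat list set set \<Rightarrow> (nat \<Rightarrow> nat) set set" where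
  "tree_ideal P =
    {X. X \<subseteq> incr_inf \<and> (\<forall>T\<in>P. \<exists>T'\<in>P. T' \<subseteq> T \<and> branches T' \<inter> X = {})}"

(* F is meant to consist of infinite sets; enumerate x is then the increasing enumeration of x. *)
definition tree_of :: "nat set set \<Rightarrow> nat list set" where
  "tree_of F = {init_seg (enumerate x) n | x n. x \<in> F}"

(* A partial function from omega to 2 = {0, 1}, with False for 0 and True for 1. *)
definition silver_tree :: "(nat \<rightharpoonup> bool) \<Rightarrow> nat list set" where
  "silver_tree f = tree_of {x. infinite x \<and> x \<inter> dom f = {k. f k = Some True}}"

definition silver_trees :: "nat list set set" where
  "silver_trees = {silver_tree f | f. infinite (- dom f)}"

definition mathias_tree :: "nat set \<Rightarrow> nat set \<Rightarrow> nat list set" where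
  "mathias_tree s A = tree_of {s \<union> y | y. y \<subseteq> A \<and> infinite y}"

(* The condition max s < min A is stated elementwise, so that s may be empty. *)
definition mathias_trees :: "nat list set set" where
  "mathias_trees =
    {mathias_tree s A | s A. finite s \<and> infinite A \<and> (\<forall>i\<in>s. \<forall>j\<in>A. i < j)}"

definition v0 :: "(nat \<Rightarrow> nat) set set" where
  "v0 = tree_ideal silver_trees"

definition r0 :: "(nat \<Rightarrow> nat) set set" where
  "r0 = tree_ideal mathias_trees"

lemma is_tree_tree_of:
  assumes "F \<noteq> {}" and inf: "\<And>x. x \<in> F \<Longrightarrow> infinite x"
  shows "is_tree (tree_of F)"
  unfolding is_tree_def
proof (intro conjI ballI allI impI)
  show "tree_of F \<noteq> {}"
    using assms(1) unfolding tree_of_def by blast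
  show "tree_of F \<subseteq> incr_fin"
    using inf
    by (auto simp: tree_of_def incr_fin_def init_seg_def sorted_wrt_iff_nth_less
        intro: enumerate_mono)
next
  fix t u assume "t \<in> tree_of F" and pre: "prefix u t"
  then obtain x n where x: "x \<in> F" and t: "t = init_seg (enumerate x) n"
    unfolding tree_of_def by blast
  have "u = take (length u) t"
    using pre by (auto simp: prefix_def)
  also have "take (length u) t = init_seg (enumerate x) (min (length u) n)"
    unfolding t init_seg_def by (cases "length u \<le> n") (simp_all add: take_map)
  finally have "u = init_seg (enumerate x) (min (length u) n)" .
  then show "u \<in> tree_of F"
    using x unfolding tree_of_def by blast
qed

lemma is_tree_silver:
  assumes "T \<in> silver_trees"
  shows "is_tree T"
proof -
  obtain f where T: "T = silver_tree f" and f: "infinite (- dom f)"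
    using assms unfolding silver_trees_def by blast
  let ?x = "- dom f \<union> {k. f k = Some True}"
  have "infinite ?x" and "?x \<inter> dom f = {k. f k = Some True}"
    using f by auto
  then have "{x. infinite x \<and> x \<inter> dom f = {k. f k = Some True}} \<noteq> {}"
    by blast
  then show ?thesis
    unfolding T silver_tree_def by (intro is_tree_tree_of) auto
qed

lemma is_tree_mathias:
  assumes "T \<in> mathias_trees"
  shows "is_tree T"
proof -
  obtain s A where T: "T = mathias_tree s A" and A: "infinite A"
    using assms unfolding mathias_trees_def by blast
  have "{s \<union> y | y. y \<subseteq> A \<and> infinite y} \<noteq> {}"
    using A by blast
  then show ?thesis
    unfolding T mathias_tree_def by (intro is_tree_tree_of) auto
qed

end

theory Submission
  imports Defs "HOL-Library.Equipollence" "HOL-Library.Nat_Bijection"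
begin

text \<open>
  Let \<open>\<c>\<close> be the cardinality of the continuum.
  A recursion of length \<open>\<c>\<close> builds partial functions \<open>g\<^sub>\<alpha>\<close>, one below each Silver tree, and
  sets \<open>x\<^sub>\<alpha>\<close>, one in each Mathias tree, such that no \<open>x\<^sub>\<alpha>\<close> is a branch of any \<open>g\<^sub>\<beta>\<close>. At each
  stage fewer than \<open>\<c>\<close> objects must be avoided. A new \<open>g\<close> is found because every Silver tree has
  \<open>\<c>\<close> many subtrees with pairwise disjoint sets of branches. A new \<open>x\<close> is found because all
  earlier \<open>g\<^sub>\<beta>\<close> take the value 1 on an infinite set, which every branch must contain, and such a
  set lies in at most one of the \<open>\<c>\<close> many members of an almost disjoint family.
\<close>

section \<open>Mutual avoidance by transfinite recursion\<close>

text \<open>Cardinals are comparable, so being strictly smaller means admitting no injection in the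
  other direction. This carries facts about the order \<open>card_of\<close> over to
  equipollence.\<close>

lemma lesspoll_iff_ordLess: "A \<prec> B \<longleftrightarrow> (card_of A, card_of B) \<in> ordLess"
proof -
  have "A \<prec> B \<longleftrightarrow> \<not> B \<lesssim> A"
    using ordLeq_total[OF card_of_Well_order card_of_Well_order, of A B]
      lepoll_antisym[of A B] eqpoll_imp_lepoll[OF eqpoll_sym, of A B]
    unfolding lesspoll_def card_of_ordLeq[symmetric] lepoll_def by blast
  also have "\<dots> \<longleftrightarrow> (card_of A, card_of B) \<in> ordLess"
    using card_of_ordLess[of B A] unfolding lepoll_def .
  finally show ?thesis .
qed

text \<open>The cardinal order on \<open>'i\<close> is an initial ordinal, so its proper initial
  segments are smaller than the whole type. Each stage of the recursion thus has few
  predecessors.\<close>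

lemma wellorder_small_initial_segments:
  obtains r :: "('i \<times> 'i) set"
  where "wf r" and "\<And>i j. i \<noteq> j \<Longrightarrow> (i, j) \<in> r \<or> (j, i) \<in> r"
    and "\<And>i. {j. (j, i) \<in> r} \<prec> (UNIV :: 'i set)"
proof
  let ?r = "card_of (UNIV :: 'i set)"
  have wo: "Well_order ?r" and field: "Field ?r = UNIV"
    using card_of_Well_order[of "UNIV :: 'i set"] by (simp_all add: Field_card_of)
  show "wf (?r - Id)"
    using wo by (simp add: well_order_on_def)
  show "(i, j) \<in> ?r - Id \<or> (j, i) \<in> ?r - Id" if "i \<noteq> j" for i j
    using wo that field by (auto simp: well_order_on_def linear_order_on_def total_on_def)
  show "{j. (j, i) \<in> ?r - Id} \<prec> (UNIV :: 'i set)" for i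
  proof -
    have "{j. (j, i) \<in> ?r - Id} = underS ?r i"
      by (auto simp: underS_def)
    then show ?thesis
      using card_of_underS[OF card_of_Card_order, of i "UNIV :: 'i set"] field
      by (simp add: lesspoll_iff_ordLess)
  qed
qed

lemma insert_lesspoll:
  assumes "infinite B" "A \<prec> B"
  shows "insert a A \<prec> B"
proof (cases "finite A")
  case True
  then show ?thesis
    using assms(1) by (intro finite_lesspoll_infinite) auto
next
  case False
  then show ?thesis
    using assms(2) by (rule eq_lesspoll_trans[OF infinite_insert_eqpoll])
qed

lemma lepoll_UNIV_imp_enum:
  assumes "P \<lesssim> (UNIV :: 'i set)" "P \<noteq> {}"
  obtains p :: "'i \<Rightarrow> 'a" where "range p = P"
proof -
  obtain q :: "'i \<Rightarrow> 'a" where q: "P \<subseteq> range q"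
    using assms(1) by (auto simp: lepoll_iff)
  obtain c where "c \<in> P"
    using assms(2) by blast
  \<comment> \<open>\<open>q\<close> may also take values outside \<open>P\<close>; these are
    replaced by \<open>c\<close>.\<close>
  with q have "range (\<lambda>i. if q i \<in> P then q i else c) = P"
    by (auto simp: image_iff split: if_splits)
  then show thesis
    by (rule that)
qed

text \<open>Stage \<open>i\<close> meets the \<open>i\<close>-th member of \<open>P\<close> and then
  the \<open>i\<close>-th member of \<open>Q\<close>, avoiding the earlier choices, which are fewer
  than the elements of \<open>'i\<close>. In the application \<open>P\<close> consists of sets of
  Silver functions and \<open>Q\<close> of sets of Mathias branches;
  \<open>T \<subseteq> \<Union>P\<close> passes on that the earlier functions have infinitely many
  ones.\<close>

lemma mutual_avoidance:
  fixes P :: "'a set set" and Q :: "'b set set" and bad :: "'a \<Rightarrow> 'b \<Rightarrow> bool"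
  assumes inf: "infinite (UNIV :: 'i set)"
    and P: "P \<lesssim> (UNIV :: 'i set)" "P \<noteq> {}"
    and Q: "Q \<lesssim> (UNIV :: 'i set)" "Q \<noteq> {}"
    and avoid_left: "\<And>C S. C \<in> P \<Longrightarrow> S \<prec> (UNIV :: 'i set) \<Longrightarrow> \<exists>c\<in>C. \<forall>s\<in>S. \<not> bad c s"
    and avoid_right: "\<And>D T. D \<in> Q \<Longrightarrow> T \<subseteq> \<Union>P \<Longrightarrow> T \<prec> (UNIV :: 'i set) \<Longrightarrow>
      \<exists>d\<in>D. \<forall>t\<in>T. \<not> bad t d"
  obtains G X where "\<And>C. C \<in> P \<Longrightarrow> C \<inter> G \<noteq> {}" "\<And>D. D \<in> Q \<Longrightarrow> D \<inter> X \<noteq> {}"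
    "X \<subseteq> \<Union>Q" "\<And>g x. g \<in> G \<Longrightarrow> x \<in> X \<Longrightarrow> \<not> bad g x"
proof -
  obtain r :: "('i \<times> 'i) set" where wf: "wf r"
    and tot: "\<And>i j. i \<noteq> j \<Longrightarrow> (i, j) \<in> r \<or> (j, i) \<in> r"
    and small: "\<And>i. {j. (j, i) \<in> r} \<prec> (UNIV :: 'i set)"
    by (rule wellorder_small_initial_segments) blast
  obtain p :: "'i \<Rightarrow> 'a set" where p: "range p = P"
    using P by (rule lepoll_UNIV_imp_enum)
  obtain q :: "'i \<Rightarrow> 'b set" where q: "range q = Q"
    using Q by (rule lepoll_UNIV_imp_enum)
  have "\<exists>h. \<forall>i. fst (h i) \<in> p i \<and> snd (h i) \<in> q i \<and> \<not> bad (fst (h i)) (snd (h i)) \<and>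
    (\<forall>j. (j, i) \<in> r \<longrightarrow> \<not> bad (fst (h i)) (snd (h j)) \<and> \<not> bad (fst (h j)) (snd (h i)))"
  proof (rule dependent_wf_choice[OF wf, where P = "\<lambda>h i y. fst y \<in> p i \<and> snd y \<in> q i \<and>
        \<not> bad (fst y) (snd y) \<and>
        (\<forall>j. (j, i) \<in> r \<longrightarrow> \<not> bad (fst y) (snd (h j)) \<and> \<not> bad (fst (h j)) (snd y))"])
    fix h :: "'i \<Rightarrow> 'a \<times> 'b" and i
    assume IH: "\<And>j. (j, i) \<in> r \<Longrightarrow> fst (h j) \<in> p j \<and> snd (h j) \<in> q j \<and>
      \<not> bad (fst (h j)) (snd (h j)) \<and>
      (\<forall>k. (k, j) \<in> r \<longrightarrow> \<not> bad (fst (h j)) (snd (h k)) \<and> \<not> bad (fst (h k)) (snd (h j)))"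
    let ?I = "{j. (j, i) \<in> r}"
    have "(snd \<circ> h) ` ?I \<prec> (UNIV :: 'i set)"
      using small image_lepoll lesspoll_trans1 by blast
    then obtain g where g: "g \<in> p i" "\<forall>s \<in> (snd \<circ> h) ` ?I. \<not> bad g s"
      using avoid_left[of "p i"] p by blast
    \<comment> \<open>The new \<open>g\<close> is included so that \<open>x\<close> also avoids its
      partner from the same stage.\<close>
    let ?T = "insert g ((fst \<circ> h) ` ?I)"
    have "(fst \<circ> h) ` ?I \<prec> (UNIV :: 'i set)"
      using small image_lepoll lesspoll_trans1 by blast
    then have "?T \<prec> (UNIV :: 'i set)"
      by (rule insert_lesspoll[OF inf])
    moreover have "?T \<subseteq> \<Union>P"
      using IH g(1) p by fastforce
    ultimately obtain x where "x \<in> q i" "\<forall>t\<in>?T. \<not> bad t x"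
      using avoid_right[of "q i" ?T] q by blast
    then show "\<exists>y. fst y \<in> p i \<and> snd y \<in> q i \<and> \<not> bad (fst y) (snd y) \<and>
        (\<forall>j. (j, i) \<in> r \<longrightarrow> \<not> bad (fst y) (snd (h j)) \<and> \<not> bad (fst (h j)) (snd y))"
      using g by (intro exI[of _ "(g, x)"]) auto
  qed auto
  then obtain h where h: "\<And>i. fst (h i) \<in> p i" "\<And>i. snd (h i) \<in> q i"
      "\<And>i. \<not> bad (fst (h i)) (snd (h i))"
      "\<And>i j. (j, i) \<in> r \<Longrightarrow> \<not> bad (fst (h i)) (snd (h j)) \<and> \<not> bad (fst (h j)) (snd (h i))"
    by blast
  show thesis
  proof (rule that[of "range (fst \<circ> h)" "range (snd \<circ> h)"])
    show "C \<inter> range (fst \<circ> h) \<noteq> {}" if "C \<in> P" for C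
      using that p h(1) by fastforce
    show "D \<inter> range (snd \<circ> h) \<noteq> {}" if "D \<in> Q" for D
      using that q h(2) by fastforce
    show "range (snd \<circ> h) \<subseteq> \<Union>Q"
      using q h(2) by fastforce
    \<comment> \<open>Of two distinct stages, the later one took care of the pair.\<close>
    have "\<not> bad (fst (h i)) (snd (h j))" for i j
      using h(3,4) tot by (cases "i = j") blast+
    then show "\<not> bad g x" if "g \<in> range (fst \<circ> h)" "x \<in> range (snd \<circ> h)" for g x
      using that by auto
  qed
qed

text \<open>If every \<open>z\<close> were related to some element of \<open>S\<close>, choosing one
  for each \<open>z\<close> would be injective, as an element of \<open>S\<close> serves only one
  \<open>z\<close>.\<close>

lemma lesspoll_pigeonhole:
  assumes "S \<prec> (UNIV :: 'z set)"
    and unique: "\<And>s z z'. s \<in> S \<Longrightarrow> R z s \<Longrightarrow> R z' s \<Longrightarrow> z = z'"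
  obtains z :: 'z where "\<And>s. s \<in> S \<Longrightarrow> \<not> R z s"
proof -
  have False if hit: "\<And>z. \<exists>s\<in>S. R z s"
  proof -
    obtain w where w: "\<And>z. w z \<in> S \<and> R z (w z)"
      using hit by metis
    then have "inj w"
      using unique by (metis injI)
    then have "(UNIV :: 'z set) \<lesssim> S"
      using w unfolding lepoll_def by blast
    then show False
      using assms(1) lesspoll_trans2 lesspoll_not_refl by blast
  qed
  then show thesis
    using that by blast
qed

section \<open>Large families of subtrees\<close>

text \<open>The path that the characteristic function of \<open>z\<close> traces through the full
  binary tree, each node coded by its length \<open>n\<close> and its content. Storing
  \<open>n\<close> keeps the nodes distinct.\<close>

definition init_codes :: "nat set \<Rightarrow> nat set" where
  "init_codes z = range (\<lambda>n. prod_encode (n, set_encode (z \<inter> {..<n})))"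

lemma infinite_init_codes: "infinite (init_codes z)"
  unfolding init_codes_def by (rule range_inj_infinite) (auto intro!: injI)

text \<open>Once \<open>z\<close> and \<open>z'\<close> differ at \<open>k\<close>, their paths
  share no node of length above \<open>k\<close>.\<close>

lemma finite_Int_init_codes:
  assumes "z \<noteq> z'"
  shows "finite (init_codes z \<inter> init_codes z')"
proof -
  obtain k where k: "k \<in> z \<longleftrightarrow> k \<notin> z'"
    using assms by blast
  let ?c = "\<lambda>n. prod_encode (n, set_encode (z \<inter> {..<n}))"
  have "init_codes z \<inter> init_codes z' \<subseteq> ?c ` {..k}"
  proof
    fix m assume "m \<in> init_codes z \<inter> init_codes z'"
    then obtain n n' where m: "m = ?c n" "m = prod_encode (n', set_encode (z' \<inter> {..<n'}))"
      unfolding init_codes_def by blast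
    \<comment> \<open>The length is part of the code, so \<open>n = n'\<close>.\<close>
    then have "set_encode (z \<inter> {..<n}) = set_encode (z' \<inter> {..<n})"
      by (metis prod.inject prod_encode_eq)
    then have "z \<inter> {..<n} = z' \<inter> {..<n}"
      by (subst (asm) set_encode_eq) auto
    then have "n \<le> k"
      using k by (metis IntE IntI lessThan_iff not_le)
    then show "m \<in> ?c ` {..k}"
      using m(1) by blast
  qed
  then show ?thesis
    using finite_subset by blast
qed

text \<open>The paths through the binary tree are transported into \<open>A\<close> along its
  enumeration.\<close>

lemma almost_disjoint_family:
  fixes A :: "nat set"
  assumes "infinite A"
  obtains y :: "nat set \<Rightarrow> nat set"
  where "\<And>z. y z \<subseteq> A" "\<And>z. infinite (y z)" "\<And>z z'. z \<noteq> z' \<Longrightarrow> finite (y z \<inter> y z')"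
proof (rule that[of "\<lambda>z. enumerate A ` init_codes z"])
  have inj: "inj (enumerate A)"
    using assms by (rule inj_enumerate)
  show "enumerate A ` init_codes z \<subseteq> A" for z
    using enumerate_in_set[OF assms] by blast
  show "infinite (enumerate A ` init_codes z)" for z
    using infinite_init_codes inj by (metis finite_imageD inj_on_subset subset_UNIV)
  show "finite (enumerate A ` init_codes z \<inter> enumerate A ` init_codes z')" if "z \<noteq> z'" for z z'
    using finite_Int_init_codes[OF that] inj by (metis finite_imageI image_Int)
qed

text \<open>If \<open>B t\<close> lay in \<open>s \<union> y z\<close> for two different
  \<open>z\<close>, it would lie in the finite set \<open>s \<union> (y z \<inter> y z')\<close>. So
  each \<open>t\<close> rules out at most one of continuum many \<open>z\<close>.\<close>

lemma mathias_avoid: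
  fixes s A :: "nat set" and B :: "'a \<Rightarrow> nat set"
  assumes "finite s" "infinite A"
    and T: "T \<prec> (UNIV :: nat set set)" "\<And>t. t \<in> T \<Longrightarrow> infinite (B t)"
  shows "\<exists>y. y \<subseteq> A \<and> infinite y \<and> (\<forall>t\<in>T. \<not> B t \<subseteq> s \<union> y)"
proof -
  obtain y :: "nat set \<Rightarrow> nat set" where y: "\<And>z. y z \<subseteq> A" "\<And>z. infinite (y z)"
    "\<And>z z'. z \<noteq> z' \<Longrightarrow> finite (y z \<inter> y z')"
    by (rule almost_disjoint_family[OF assms(2)]) blast
  have "z = z'" if "t \<in> T" "B t \<subseteq> s \<union> y z" "B t \<subseteq> s \<union> y z'" for t z z'
  proof (rule ccontr)
    assume "z \<noteq> z'"
    then have "finite (s \<union> (y z \<inter> y z'))"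
      using y(3) assms(1) by simp
    moreover have "B t \<subseteq> s \<union> (y z \<inter> y z')"
      using that by blast
    ultimately show False
      using T(2)[OF that(1)] finite_subset by blast
  qed
  then obtain z where "\<And>t. t \<in> T \<Longrightarrow> \<not> B t \<subseteq> s \<union> y z"
    using lesspoll_pigeonhole[OF T(1), of "\<lambda>z t. B t \<subseteq> s \<union> y z"] by blast
  then show ?thesis
    using y by blast
qed

text \<open>Each set \<open>z\<close> is written into free coordinates of \<open>f\<close>, giving
  an extension \<open>g z\<close>. A set \<open>x\<close> compatible with \<open>g z\<close>
  determines \<open>z\<close>, so each \<open>x \<in> S\<close> rules out at most one
  \<open>z\<close>.\<close>

lemma silver_avoid:
  fixes f :: "nat \<rightharpoonup> bool"
  assumes "infinite (- dom f)" and S: "S \<prec> (UNIV :: nat set set)"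
  shows "\<exists>g. f \<subseteq>\<^sub>m g \<and> infinite (- dom g) \<and> infinite {k. g k = Some True} \<and>
    (\<forall>x\<in>S. x \<inter> dom g \<noteq> {k. g k = Some True})"
proof -
  let ?D = "- dom f"
  let ?e = "enumerate ?D"
  define i where "i = inv ?e"
  have inj: "inj ?e"
    using assms(1) by (rule inj_enumerate)
  have i: "i (?e n) = n" and e: "f (?e n) = None" for n
    using inj enumerate_in_set[OF assms(1), of n] by (auto simp: i_def)
  \<comment> \<open>The free coordinates are split by position modulo 3: class 0 supplies infinitely
    many ones, class 1 stores \<open>z\<close>, class 2 stays undefined to keep the domain
    coinfinite.\<close>
  define g where "g z k = (if k \<in> dom f then f k else if i k mod 3 = 0 then Some True
    else if i k mod 3 = 1 then Some (i k div 3 \<in> z) else None)" for z k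
  have ge: "g z (?e (3 * n)) = Some True" "g z (?e (3 * n + 1)) = Some (n \<in> z)"
    "g z (?e (3 * n + 2)) = None" for z n
  proof -
    have "(3 * n + 1) mod 3 = 1" "(3 * n + 1) div 3 = n" "(3 * n + 2) mod 3 = 2" for n :: nat
      by presburger+
    then show "g z (?e (3 * n)) = Some True" "g z (?e (3 * n + 1)) = Some (n \<in> z)"
      "g z (?e (3 * n + 2)) = None"
      by (simp_all only: g_def domIff e i) simp_all
  qed
  have inf: "infinite (range (\<lambda>n. ?e (3 * n + j)))" for j
    by (rule range_inj_infinite) (use inj in \<open>auto intro!: injI dest: injD\<close>)
  have ext: "f \<subseteq>\<^sub>m g z" for z
    by (auto simp: map_le_def g_def)
  have co: "infinite (- dom (g z))" for z
  proof (rule infinite_super[OF _ inf[of 2]])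
    show "range (\<lambda>n. ?e (3 * n + 2)) \<subseteq> - dom (g z)"
      using ge(3) by (auto simp: domIff)
  qed
  have ones: "infinite {k. g z k = Some True}" for z
  proof (rule infinite_super[OF _ inf[of 0]])
    show "range (\<lambda>n. ?e (3 * n + 0)) \<subseteq> {k. g z k = Some True}"
      using ge(1) by auto
  qed
  have unique: "z = z'"
    if z: "x \<inter> dom (g z) = {k. g z k = Some True}"
      and z': "x \<inter> dom (g z') = {k. g z' k = Some True}" for x z z'
  proof -
    \<comment> \<open>The coordinates of class 1 lie in the domain of every \<open>g w\<close>, so
      \<open>x\<close> restricted to them is a copy of \<open>w\<close>.\<close>
    have mem: "?e (3 * n + 1) \<in> x \<longleftrightarrow> n \<in> w"
      if w: "x \<inter> dom (g w) = {k. g w k = Some True}" for n w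
    proof -
      have "?e (3 * n + 1) \<in> x \<inter> dom (g w) \<longleftrightarrow> n \<in> w"
        unfolding w using ge(2) by simp
      then show ?thesis
        using ge(2)[of w n] by (simp add: domIff)
    qed
    show ?thesis
      using mem[OF z, symmetric] mem[OF z', symmetric] by (simp only: set_eq_iff simp_thms)
  qed
  obtain z where "\<And>x. x \<in> S \<Longrightarrow> x \<inter> dom (g z) \<noteq> {k. g z k = Some True}"
  proof (rule lesspoll_pigeonhole[of S "\<lambda>z x. x \<inter> dom (g z) = {k. g z k = Some True}"])
    show "S \<prec> (UNIV :: nat set set)"
      by (rule S)
  qed (rule unique, assumption+, blast)
  then show ?thesis
    using ext[of z] co[of z] ones[of z] by (intro exI[of _ "g z"]) simp
qed

section \<open>Branches\<close>

lemma enumerate_in_incr_inf: "infinite x \<Longrightarrow> enumerate x \<in> incr_inf"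
  by (auto simp: incr_inf_def intro!: strict_monoI enumerate_mono)

lemma enumerate_in_branches:
  assumes "x \<in> F" "infinite x"
  shows "enumerate x \<in> branches (tree_of F)"
  using assms enumerate_in_incr_inf by (auto simp: branches_def tree_of_def)

text \<open>Since \<open>n \<le> enumerate x n\<close>, an element \<open>k\<close> of
  \<open>x\<close> occurs among its first \<open>Suc k\<close> entries.\<close>

lemma mem_cong_of_init_seg_eq:
  assumes "infinite x" "init_seg (enumerate x) (Suc k) = init_seg (enumerate w) (Suc k)"
    "infinite w" "k \<in> x"
  shows "k \<in> w"
proof -
  obtain n where n: "k = enumerate x n"
    using enumerate_Ex assms(1,4) by metis
  then have "n < Suc k"
    using le_enumerate[OF assms(1), of n] by simp
  then have "enumerate x n = enumerate w n"
    using assms(2) unfolding init_seg_def map_eq_conv by (metis atLeastLessThan_iff atLeast_upt lessThan_iff)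
  then show ?thesis
    using n enumerate_in_set[OF assms(3)] by simp
qed

text \<open>Each initial segment of a branch may come from a different \<open>w\<close> in the
  generating family. Membership of a single \<open>k\<close> is decided by \<open>Suc k\<close>
  entries, so the Silver condition still passes to the branch.\<close>

lemma silver_branch:
  assumes "infinite x" "enumerate x \<in> branches (silver_tree f)"
  shows "x \<inter> dom f = {k. f k = Some True}"
proof -
  have "k \<in> x \<longleftrightarrow> f k = Some True" if "k \<in> dom f" for k
  proof -
    have "init_seg (enumerate x) (Suc k) \<in> silver_tree f"
      using assms(2) by (auto simp: branches_def)
    then obtain w n where w: "infinite w" "w \<inter> dom f = {k. f k = Some True}"
      and eq: "init_seg (enumerate x) (Suc k) = init_seg (enumerate w) n"
      unfolding silver_tree_def tree_of_def by blast
    have "length (init_seg (enumerate x) (Suc k)) = length (init_seg (enumerate w) n)"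
      using eq by simp
    then have "n = Suc k"
      by (simp add: init_seg_def)
    then have "k \<in> x \<longleftrightarrow> k \<in> w"
      using mem_cong_of_init_seg_eq assms(1) w(1) eq by metis
    then show ?thesis
      using w(2) that by blast
  qed
  then show ?thesis
    by auto
qed

lemma silver_tree_antimono:
  assumes "f \<subseteq>\<^sub>m g"
  shows "silver_tree g \<subseteq> silver_tree f"
proof -
  have "x \<inter> dom f = {k. f k = Some True}" if "x \<inter> dom g = {k. g k = Some True}" for x
  proof -
    have dom: "f k = g k" if "k \<in> dom f" for k
      using assms that by (auto simp: map_le_def)
    show ?thesis
    proof (intro set_eqI iffI)
      fix k assume "k \<in> x \<inter> dom f"
      then have "k \<in> x \<inter> dom g" "f k = g k"
        using dom by (auto simp: domIff)
      then show "k \<in> {k. f k = Some True}"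
        using that by simp
    next
      fix k assume k: "k \<in> {k. f k = Some True}"
      then have "k \<in> {k. g k = Some True}"
        using dom[of k] by (simp add: domIff)
      then show "k \<in> x \<inter> dom f"
        using that k by blast
    qed
  qed
  then show ?thesis
    unfolding silver_tree_def tree_of_def by blast
qed

section \<open>Bounding the number of trees by the continuum\<close>

lemma set_pairs_lepoll: "(UNIV :: (nat set \<times> nat set) set) \<lesssim> (UNIV :: nat set set)"
proof -
  \<comment> \<open>A pair of sets is stored as their disjoint sum, coded back into the
    naturals.\<close>
  have "inj (\<lambda>(a :: nat set, b :: nat set). sum_encode ` (a <+> b))"
  proof (rule injI, clarify)
    fix a b c d :: "nat set"
    assume "sum_encode ` (a <+> b) = sum_encode ` (c <+> d)"
    then have "a <+> b = c <+> d"
      by (simp add: inj_image_eq_iff inj_sum_encode)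
    then show "a = c \<and> b = d"
      by (auto simp: Plus_def)
  qed
  then show ?thesis
    unfolding lepoll_def by blast
qed

lemma partial_functions_lepoll: "(UNIV :: (nat \<rightharpoonup> bool) set) \<lesssim> (UNIV :: nat set set)"
proof -
  have "inj (\<lambda>f :: nat \<rightharpoonup> bool. (dom f, {k. f k = Some True}))"
  proof (rule injI, rule ext)
    fix f g :: "nat \<rightharpoonup> bool" and k
    assume "(dom f, {k. f k = Some True}) = (dom g, {k. g k = Some True})"
    then have "k \<in> dom f \<longleftrightarrow> k \<in> dom g" "f k = Some True \<longleftrightarrow> g k = Some True"
      by blast+
    then show "f k = g k"
      by (cases "f k"; cases "g k") auto
  qed
  then have "(UNIV :: (nat \<rightharpoonup> bool) set) \<lesssim> (UNIV :: (nat set \<times> nat set) set)"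
    unfolding lepoll_def by blast
  then show ?thesis
    using set_pairs_lepoll by (rule lepoll_trans)
qed

section \<open>A set in \<open>v0\<close> that meets every Mathias tree\<close>

theorem theorem2p4:
  shows "\<exists>X. X \<subseteq> incr_inf \<and> X \<in> v0 \<and> X \<notin> r0"
proof -
  \<comment> \<open>Asking for infinitely many ones makes \<open>mathias_avoid\<close> applicable to
    the functions chosen earlier.\<close>
  define C where "C f = {g. f \<subseteq>\<^sub>m g \<and> infinite (- dom g) \<and> infinite {k. g k = Some True}}"
    for f :: "nat \<rightharpoonup> bool"
  define D where "D = (\<lambda>(s, A). {s \<union> y | y. y \<subseteq> A \<and> infinite (y :: nat set)})"
  define P where "P = C ` {f. infinite (- dom f)}"
  define Q where "Q = D ` {(s, A). finite s \<and> infinite A}"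
  \<comment> \<open>For infinite \<open>x\<close> this says that \<open>x\<close> is a branch of the
    Silver tree of \<open>g\<close>, stated for the set instead of its enumeration.\<close>
  define bad where "bad g x \<longleftrightarrow> x \<inter> dom g = {k. g k = Some True}"
    for g :: "nat \<rightharpoonup> bool" and x
  obtain G X where G: "\<And>K. K \<in> P \<Longrightarrow> K \<inter> G \<noteq> {}"
    and X: "\<And>K. K \<in> Q \<Longrightarrow> K \<inter> X \<noteq> {}" "X \<subseteq> \<Union>Q"
    and good: "\<And>g x. g \<in> G \<Longrightarrow> x \<in> X \<Longrightarrow> \<not> bad g x"
  proof (rule mutual_avoidance[of P Q bad, where 'i = "nat set"])
    show "infinite (UNIV :: nat set set)"
      by (simp add: Finite_Set.finite_set)
    show "P \<lesssim> (UNIV :: nat set set)"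
      unfolding P_def
      by (rule lepoll_trans[OF image_lepoll lepoll_trans[OF subset_imp_lepoll[OF subset_UNIV] partial_functions_lepoll]])
    have "infinite (- dom (Map.empty :: nat \<rightharpoonup> bool))"
      by simp
    then show "P \<noteq> {}"
      unfolding P_def by blast
    show "Q \<lesssim> (UNIV :: nat set set)"
      unfolding Q_def
      by (rule lepoll_trans[OF image_lepoll lepoll_trans[OF subset_imp_lepoll[OF subset_UNIV] set_pairs_lepoll]])
    have "({}, UNIV) \<in> {(s, A). finite s \<and> infinite (A :: nat set)}"
      by simp
    then show "Q \<noteq> {}"
      unfolding Q_def by blast
    show "\<exists>c\<in>K. \<forall>x\<in>S. \<not> bad c x" if K: "K \<in> P" and small: "S \<prec> (UNIV :: nat set set)" for K S
    proof -
      obtain f where f: "infinite (- dom f)" "K = C f"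
        using K unfolding P_def by blast
      show ?thesis
        using silver_avoid[OF f(1) small] unfolding f(2) C_def bad_def by blast
    qed
    show "\<exists>d\<in>K. \<forall>t\<in>T. \<not> bad t d"
      if K: "K \<in> Q" and T: "T \<subseteq> \<Union>P" and small: "T \<prec> (UNIV :: nat set set)" for K T
    proof -
      obtain s A where sA: "finite s" "infinite A" "K = D (s, A)"
        using K unfolding Q_def by blast
      have "infinite {k. t k = Some True}" if "t \<in> T" for t
        using that T unfolding P_def C_def by blast
      then obtain y where y: "y \<subseteq> A" "infinite y" "\<forall>t\<in>T. \<not> {k. t k = Some True} \<subseteq> s \<union> y"
        using mathias_avoid[OF sA(1,2) small, of "\<lambda>t. {k. t k = Some True}"] by blast
      have "s \<union> y \<in> K"
        unfolding sA(3) D_def using y(1,2) by blast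
      \<comment> \<open>A branch of \<open>t\<close> contains all the ones of
        \<open>t\<close>.\<close>
      moreover have "\<forall>t\<in>T. \<not> bad t (s \<union> y)"
        unfolding bad_def using y(3) by blast
      ultimately show ?thesis
        by blast
    qed
  qed blast
  \<comment> \<open>Every member of \<open>X\<close> comes from some \<open>D (s, A)\<close>, so
    \<open>enumerate x\<close> really is an increasing enumeration.\<close>
  have inf: "infinite x" if "x \<in> X" for x
    using that X(2) by (auto simp: Q_def D_def)
  let ?X = "enumerate ` X"
  have sub: "?X \<subseteq> incr_inf"
    using inf enumerate_in_incr_inf by blast
  moreover have "?X \<in> v0"
  proof -
    have "\<exists>T'\<in>silver_trees. T' \<subseteq> T \<and> branches T' \<inter> ?X = {}" if T: "T \<in> silver_trees" for T
    proof -
      obtain f where f: "T = silver_tree f" "infinite (- dom f)"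
        using T unfolding silver_trees_def by blast
      then obtain g where g: "g \<in> C f" "g \<in> G"
        using G[of "C f"] unfolding P_def by blast
      then have "silver_tree g \<in> silver_trees" "silver_tree g \<subseteq> T"
        using silver_tree_antimono f by (auto simp: C_def silver_trees_def)
      moreover have "branches (silver_tree g) \<inter> ?X = {}"
      proof -
        have "enumerate x \<notin> branches (silver_tree g)" if "x \<in> X" for x
          using silver_branch[OF inf[OF that]] good[OF g(2) that] by (auto simp only: bad_def)
        then show ?thesis
          by blast
      qed
      ultimately show ?thesis
        by blast
    qed
    then show ?thesis
      using sub by (simp add: v0_def tree_ideal_def)
  qed
  moreover have "?X \<notin> r0"
  proof -
    have "branches T \<inter> ?X \<noteq> {}" if T: "T \<in> mathias_trees" for T
    proof -
      obtain s A where sA: "T = mathias_tree s A" "finite s" "infinite A"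
        using T unfolding mathias_trees_def by blast
      then obtain x where x: "x \<in> D (s, A)" "x \<in> X"
        using X(1)[of "D (s, A)"] unfolding Q_def by blast
      then have "enumerate x \<in> branches T"
        unfolding sA(1) mathias_tree_def D_def using inf
        by (intro enumerate_in_branches) auto
      then show ?thesis
        using x(2) by blast
    qed
    \<comment> \<open>Without any Mathias tree the condition defining \<open>r0\<close> would hold
      vacuously, so one is exhibited; below it no Mathias tree misses \<open>?X\<close>.\<close>
    moreover have "mathias_tree {} UNIV \<in> mathias_trees"
      unfolding mathias_trees_def by blast
    ultimately show ?thesis
      by (auto simp: r0_def tree_ideal_def)
  qed
  ultimately show ?thesis
    by blast
qed

end
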